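(* There exists an infinite family of finite simple graphs $G$, where $n$ denotes the order of $G$, such that each $G$ in the family satisfies \[ \delta(G) \geq \frac{n}{2} + \frac{\ln n}{2\ln(27/4)} \] and $G$ does not have an orientation of diameter $2$.
   Context: $\delta(G)$ denotes the minimum degree of $G$ and $\ln$ is the natural logarithm. An orientation of $G$ is a digraph obtained by assigning a direction to each edge of $G$. An orientation $D$ of $G$ has diameter $2$ if for every ordered pair of distinct vertices $u,v$ there is a directed path of length at most $2$ from $u$ to $v$ in $D$, with $2$ being the maximum over all such pairs of the length of a shortest directed path. *)

theory Defs
  imports Complex_Main "HOL-Library.Extended_Nat"
    "Graph_Theory.Pair_Digraph" "Graph_Theory.Digraph_Isomorphism"
begin

text \<open>
  A finite simple graph is a \<^locale>\<open>pair_graph\<close>: a finite, loop-free, symmetric digraph without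
  parallel arcs. An edge between \<open>u\<close> and \<open>v\<close> is the pair of arcs \<open>(u, v)\<close> and \<open>(v, u)\<close>, so
  the degree of a vertex is its \<^const>\<open>out_degree\<close>.
\<close>

definition graph_order :: "'a pair_pre_digraph \<Rightarrow> nat" where
  "graph_order G = card (pverts G)"

text \<open>Only meaningful for a finite nonempty vertex set.\<close>

definition min_degree :: "'a pair_pre_digraph \<Rightarrow> nat" where
  "min_degree G = Min (out_degree (with_proj G) ` pverts G)"

definition orientation_of :: "'a pair_pre_digraph \<Rightarrow> 'a pair_pre_digraph \<Rightarrow> bool" where
  "orientation_of G D \<longleftrightarrow>
     pverts D = pverts G \<and> parcs D \<subseteq> parcs G \<and>
     (\<forall>(u, v) \<in> parcs G. (u, v) \<in> parcs D \<longleftrightarrow> (v, u) \<notin> parcs D)"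

text \<open>The infimum over the empty set is \<open>\<infinity>\<close>, the distance to an unreachable vertex.\<close>

definition digraph_distance :: "'a pair_pre_digraph \<Rightarrow> 'a \<Rightarrow> 'a \<Rightarrow> enat" where
  "digraph_distance D u v = (INF p \<in> {p. pre_digraph.apath (with_proj D) u p v}. enat (length p))"

definition digraph_diameter :: "'a pair_pre_digraph \<Rightarrow> enat" where
  "digraph_diameter D = (SUP (u, v) \<in> {(u, v). u \<in> pverts D \<and> v \<in> pverts D \<and> u \<noteq> v}. digraph_distance D u v)"

end

theory Submission
  imports Defs "HOL-Library.Nat_Bijection"
begin

text \<open>
  Take two disjoint cliques \<open>A\<close> and \<open>B\<close> with \<open>|B| = 2 ^ (2d - 1)\<close> and \<open>|A| = |B| + d\<close>, and
  designate \<open>2d - 1\<close> vertices of \<open>A\<close> as hubs. The only edges between the cliques join each vertex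
  of \<open>B\<close> to at least \<open>d\<close> hubs. The order is \<open>n = 4 ^ d + d\<close> and the minimum degree is at least
  \<open>n / 2 + d / 2 - 1\<close>, which suffices since \<open>4 < 27 / 4\<close>.

  A path of length two between a non-hub \<open>a\<close> of \<open>A\<close> and a vertex \<open>b\<close> of \<open>B\<close> passes through a hub
  adjacent to \<open>b\<close>. An orientation splits the hubs into out- and in-neighbours of \<open>a\<close>, one of the two
  classes has at least \<open>d\<close> elements, and \<open>B\<close> is rich enough to contain a vertex whose hubs are exactly
  that class. In one of the two directions there is then no path of length at most two.
\<close>

lemma digraph_distance_le_2D:
  assumes "digraph_distance D u v \<le> 2" "u \<noteq> v"
  shows "(u, v) \<in> parcs D \<or> (\<exists>w. (u, w) \<in> parcs D \<and> (w, v) \<in> parcs D)"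
proof -
  \<comment> \<open>The distance is an infimum over paths; a strict upper bound on it yields a
    witnessing path directly.\<close>
  have "digraph_distance D u v < enat 3"
    using assms(1) by (rule order.strict_trans1) (simp add: numeral_eq_enat)
  then obtain p where p: "pre_digraph.apath (with_proj D) u p v" "length p < 3"
    by (auto simp: digraph_distance_def INF_less_iff)
  from p(1) have walk: "set p \<subseteq> parcs D" "pcas u p v"
    by (simp_all add: pre_digraph.apath_def pre_digraph.awalk_def cas_with_proj_eq)
  consider "p = []" | x y where "p = [(x, y)]" | x y z w where "p = [(x, y), (z, w)]"
    using p(2) by (auto simp: numeral_3_eq_3 less_Suc_eq length_Suc_conv)
  then show ?thesis
    using walk assms(2) by cases auto
qed

lemma digraph_diameter_ge_distance:
  assumes "u \<in> pverts D" "v \<in> pverts D" "u \<noteq> v"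
  shows "digraph_distance D u v \<le> digraph_diameter D"
  unfolding digraph_diameter_def using assms by (intro SUP_upper2[of "(u, v)"]) auto

lemma digraph_iso_imp_graph_order_eq:
  assumes "digraph_iso (with_proj G) (with_proj H)"
  shows "graph_order G = graph_order H"
proof -
  from assms obtain f where f: "pre_digraph.digraph_isomorphism (with_proj G) f"
    and H: "with_proj H = app_iso f (with_proj G)"
    by (auto simp: digraph_iso_def)
  from H have "verts (with_proj H) = verts (app_iso f (with_proj G))" by simp
  then have "pverts H = iso_verts f ` pverts G" by (simp add: app_iso_def)
  moreover have "inj_on (iso_verts f) (pverts G)"
    using pre_digraph.digraph_isomorphism_inj_on_verts[OF f] by simp
  ultimately show ?thesis by (simp add: graph_order_def card_image)
qed

lemma out_degree_with_proj: "out_degree (with_proj G) u = card {v. (u, v) \<in> parcs G}"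
proof -
  have "out_arcs (with_proj G) u = Pair u ` {v. (u, v) \<in> parcs G}"
    by (auto simp: out_arcs_def)
  then show ?thesis by (simp add: out_degree_def card_image inj_on_def)
qed

text \<open>Guarantees that the code of any set of hubs is the index of a vertex of the smaller
  clique.\<close>

lemma set_encode_less_power: "A \<subseteq> {..<n} \<Longrightarrow> set_encode A < 2 ^ n"
proof -
  assume "A \<subseteq> {..<n}"
  then have "set_encode A \<le> (\<Sum>i<n. 2 ^ i)"
    unfolding set_encode_def by (intro sum_mono2) auto
  also have "\<dots> < 2 ^ n" by (induction n) auto
  finally show ?thesis .
qed

text \<open>The binary digits of \<open>j\<close> encode a set \<open>S\<close> of hubs. For
  \<open>d > 0\<close> the number of hubs is odd, so exactly one of \<open>S\<close> and its
  complement has at least \<open>d\<close> elements; that one is chosen.\<close>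

definition hub_nbrs :: "nat \<Rightarrow> nat \<Rightarrow> nat set" where
  "hub_nbrs d j =
     (let S = set_decode j \<inter> {..<2 * d - 1} in if d \<le> card S then S else {..<2 * d - 1} - S)"

text \<open>The surplus \<open>d\<close> makes up for the non-hubs having no neighbours in the other
  clique: their degree equals the lower bound for vertices of the smaller clique, which gain at
  least \<open>d\<close> hubs.\<close>

definition clique_size :: "nat \<Rightarrow> nat" where
  "clique_size d = 2 ^ (2 * d - 1) + d"

text \<open>
  The hubs are the numbers below \<open>2d - 1\<close>, the larger clique consists of the numbers below
  \<open>clique_size d\<close>, and \<open>clique_size d + j\<close> is the vertex of the smaller clique with hubs
  \<open>hub_nbrs d j\<close>.
\<close>

definition hub_adj :: "nat \<Rightarrow> nat \<Rightarrow> nat \<Rightarrow> bool" where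
  "hub_adj d u v \<longleftrightarrow> u \<noteq> v \<and>
     ((u < clique_size d \<longleftrightarrow> v < clique_size d) \<or>
      (clique_size d \<le> v \<and> u \<in> hub_nbrs d (v - clique_size d)) \<or>
      (clique_size d \<le> u \<and> v \<in> hub_nbrs d (u - clique_size d)))"

definition hub_graph :: "nat \<Rightarrow> nat pair_pre_digraph" where
  "hub_graph d =
     (let V = {..<clique_size d + 2 ^ (2 * d - 1)}
      in \<lparr>pverts = V, parcs = {(u, v). u \<in> V \<and> v \<in> V \<and> hub_adj d u v}\<rparr>)"

lemma pverts_hub_graph: "pverts (hub_graph d) = {..<clique_size d + 2 ^ (2 * d - 1)}"
  by (simp add: hub_graph_def Let_def)

lemma parcs_hub_graph:
  "(u, v) \<in> parcs (hub_graph d) \<longleftrightarrow>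
     u \<in> pverts (hub_graph d) \<and> v \<in> pverts (hub_graph d) \<and> hub_adj d u v"
  by (simp add: hub_graph_def Let_def)

lemma hub_nbrs_subset: "hub_nbrs d j \<subseteq> {..<2 * d - 1}"
  by (auto simp: hub_nbrs_def Let_def)

lemma card_hub_nbrs: "d \<le> card (hub_nbrs d j)" if "d > 0"
proof -
  have "card ({..<2 * d - 1} - set_decode j \<inter> {..<2 * d - 1})
      = 2 * d - 1 - card (set_decode j \<inter> {..<2 * d - 1})"
    by (subst card_Diff_subset) auto
  then show ?thesis using that by (auto simp: hub_nbrs_def Let_def)
qed

text \<open>Strictness leaves room for a non-hub in the larger clique, namely the vertex
  \<open>2 * d - 1\<close>.\<close>

lemma hubs_less_clique_size: "2 * d - 1 < clique_size d" if "d > 0"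
  unfolding clique_size_def using less_exp[of "2 * d - 1"] that by linarith

lemma graph_order_hub_graph: "graph_order (hub_graph d) = 4 ^ d + d" if "d > 0"
proof -
  have "(2::nat) * 2 ^ (2 * d - 1) = 2 ^ (2 * d)"
    using that by (simp flip: power_Suc)
  also have "\<dots> = 4 ^ d" by (simp add: power_mult)
  finally show ?thesis by (simp add: graph_order_def pverts_hub_graph clique_size_def)
qed

lemma pair_graph_hub_graph: "pair_graph (hub_graph d)"
proof
  show "finite (pverts (hub_graph d))" by (simp add: pverts_hub_graph)
  have "parcs (hub_graph d) \<subseteq> pverts (hub_graph d) \<times> pverts (hub_graph d)"
    by (auto simp: parcs_hub_graph)
  then show "finite (parcs (hub_graph d))"
    using \<open>finite (pverts (hub_graph d))\<close> finite_subset by blast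
  show "symmetric (with_proj (hub_graph d))"
    by (auto simp: symmetric_def parcs_hub_graph hub_adj_def intro!: symI)
qed (auto simp: parcs_hub_graph hub_adj_def)

lemma out_degree_hub_graph:
  assumes "d > 0" "u \<in> pverts (hub_graph d)"
  shows "2 ^ (2 * d - 1) + d - 1 \<le> out_degree (with_proj (hub_graph d)) u"
proof -
  define m where "m = clique_size d"
  define V where "V = pverts (hub_graph d)"
  let ?N = "{v. (u, v) \<in> parcs (hub_graph d)}"
  have V: "V = {..<m + 2 ^ (2 * d - 1)}" by (simp add: V_def m_def pverts_hub_graph)
  have "?N \<subseteq> V" by (auto simp: parcs_hub_graph V_def)
  then have fin: "finite ?N" using V finite_subset by blast
  show ?thesis
  proof (cases "u < m")
    case True
    have "card ({..<m} - {u}) \<le> card ?N"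
      using assms(2) True fin
      by (intro card_mono) (auto simp: parcs_hub_graph hub_adj_def V simp flip: V_def m_def)
    then show ?thesis
      using True by (simp add: out_degree_with_proj m_def clique_size_def)
  next
    case False
    let ?S = "hub_nbrs d (u - m)"
    have S: "?S \<subseteq> {..<m}"
      using hub_nbrs_subset[of d "u - m"] hubs_less_clique_size[OF assms(1)] by (auto simp: m_def)
    have u: "u \<in> {m..<m + 2 ^ (2 * d - 1)}"
      using False assms(2) V by (auto simp flip: V_def)
    have "card (({m..<m + 2 ^ (2 * d - 1)} - {u}) \<union> ?S) \<le> card ?N"
      using u S fin
      by (intro card_mono) (auto simp: parcs_hub_graph hub_adj_def V simp flip: V_def m_def)
    moreover have "card (({m..<m + 2 ^ (2 * d - 1)} - {u}) \<union> ?S) = 2 ^ (2 * d - 1) - 1 + card ?S"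
      using u S by (subst card_Un_disjoint) (auto intro: finite_subset)
    moreover have "(2::nat) ^ (2 * d - 1) \<ge> 1" by simp
    ultimately show ?thesis
      using card_hub_nbrs[OF assms(1), of "u - m"]
      unfolding out_degree_with_proj by linarith
  qed
qed

lemma min_degree_hub_graph:
  assumes "d > 0"
  shows "2 ^ (2 * d - 1) + d - 1 \<le> min_degree (hub_graph d)"
proof -
  have "finite (pverts (hub_graph d))" "pverts (hub_graph d) \<noteq> {}"
    using assms by (auto simp: pverts_hub_graph lessThan_empty_iff)
  then show ?thesis
    unfolding min_degree_def using out_degree_hub_graph[OF assms] by auto
qed

lemma hub_graph_not_orientable:
  assumes d: "d > 0" and D: "orientation_of (hub_graph d) D"
  shows "digraph_diameter D \<noteq> 2"
proof
  assume diam: "digraph_diameter D = 2"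
  define m where "m = clique_size d"
  \<comment> \<open>The least non-hub; since hubs are numbered from 0, \<open>{..<a}\<close> is the
    set of all hubs.\<close>
  define a where "a = 2 * d - 1"
  define S where "S = {i. i < a \<and> (a, i) \<in> parcs D}"
  \<comment> \<open>With \<open>S\<close> as its code, \<open>b\<close> has as hubs either
    \<open>S\<close> or the complement of \<open>S\<close>, whichever has at least \<open>d\<close>
    elements.\<close>
  define b where "b = m + set_encode S"
  have am: "a < m" unfolding a_def m_def by (rule hubs_less_clique_size[OF d])
  have "set_encode S < 2 ^ a" by (rule set_encode_less_power) (auto simp: S_def)
  then have verts: "a \<in> pverts D" "b \<in> pverts D" "a \<noteq> b"
    using D am by (auto simp: orientation_of_def pverts_hub_graph b_def a_def m_def)
  have arcs: "hub_adj d u v" "(v, u) \<notin> parcs D" if "(u, v) \<in> parcs D" for u v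
    using D that by (auto simp: orientation_of_def parcs_hub_graph)
  have "finite S" by (simp add: S_def)
  then have nbrs: "hub_nbrs d (b - m) = (if d \<le> card S then S else {..<a} - S)"
    by (auto simp: hub_nbrs_def b_def S_def a_def Let_def Int_absorb2 subset_eq)
  have hubs: "hub_nbrs d j \<subseteq> {..<a}" for j
    using hub_nbrs_subset by (simp add: a_def)
  have ab: "\<not> hub_adj d a b" "\<not> hub_adj d b a"
    using am hubs by (auto simp: hub_adj_def b_def simp flip: m_def)
  \<comment> \<open>As a non-hub, \<open>a\<close> has neighbours only in the larger clique, and
    those among them adjacent to \<open>b\<close> are hubs of \<open>b\<close>.\<close>
  have mid: "w \<in> hub_nbrs d (b - m)"
    if "hub_adj d a w \<or> hub_adj d w a" "hub_adj d b w \<or> hub_adj d w b" for w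
    using that am hubs by (fastforce simp: hub_adj_def b_def simp flip: m_def)
  have "digraph_distance D a b \<le> 2" "digraph_distance D b a \<le> 2"
    using digraph_diameter_ge_distance[of _ D] verts diam by metis+
  then obtain w w' where w: "(a, w) \<in> parcs D" "(w, b) \<in> parcs D"
    and w': "(b, w') \<in> parcs D" "(w', a) \<in> parcs D"
    using digraph_distance_le_2D verts(3) arcs(1) ab by metis
  have "w \<in> hub_nbrs d (b - m)" "w' \<in> hub_nbrs d (b - m)"
    using mid arcs(1) w w' by blast+
  \<comment> \<open>The path from \<open>a\<close> to \<open>b\<close> uses a hub in
    \<open>S\<close> and the path back one outside \<open>S\<close>, yet all hubs of
    \<open>b\<close> lie on the same side.\<close>
  moreover have "w \<in> {..<a} \<Longrightarrow> w \<in> S" "w' \<notin> S"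
    using w(1) w'(2) arcs(2) by (auto simp: S_def)
  ultimately show False using nbrs by (auto split: if_splits)
qed

text \<open>The shift by 2 pays for the \<open>- 1\<close> in the degree bound
  \<open>n / 2 + d / 2 - 1\<close>. Per step the right side grows by the factor
  \<open>27 / 4\<close> and the left by at most that. At \<open>d = 8\<close> the claim compares
  65544 with about 94585; at \<open>d = 7\<close> it fails.\<close>

lemma four_power_le: "(4::real) ^ d + d \<le> (27 / 4) ^ (d - 2)" if "d \<ge> 8"
  using that
proof (induction d rule: dec_induct)
  case base
  show ?case by (simp add: power_divide)
next
  case (step e)
  have "(4::real) ^ Suc e + Suc e \<le> 27 / 4 * (4 ^ e + e)"
    using step.hyps by (simp add: algebra_simps add_increasing2)
  also have "\<dots> \<le> 27 / 4 * (27 / 4) ^ (e - 2)"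
    using step by simp
  also have "\<dots> = (27 / 4) ^ (Suc e - 2)"
    using step by (simp add: Suc_diff_le flip: power_Suc)
  finally show ?case .
qed

lemma min_degree_hub_graph_ge_log:
  assumes "d \<ge> 8"
  shows "real (min_degree (hub_graph d)) \<ge>
    real (graph_order (hub_graph d)) / 2 + ln (real (graph_order (hub_graph d))) / (2 * ln (27 / 4))"
proof -
  have d: "d > 0" using assms by simp
  define n where "n = graph_order (hub_graph d)"
  have n: "n = 4 ^ d + d" using graph_order_hub_graph[OF d] by (simp add: n_def)
  have "ln (real n) \<le> ln ((27 / 4) ^ (d - 2))"
    using four_power_le[OF assms] d by (intro ln_mono) (simp_all add: n add_nonneg_pos)
  also have "\<dots> = (real d - 2) * ln (27 / 4)"
    using assms by (simp add: ln_realpow of_nat_diff)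
  finally have "ln (real n) / (2 * ln (27 / 4)) \<le> (real d - 2) / 2"
    by (simp add: field_simps)
  moreover have "real n / 2 + (real d - 2) / 2 \<le> real (min_degree (hub_graph d))"
  proof -
    have "n = 2 * 2 ^ (2 * d - 1) + d"
      by (simp add: n_def graph_order_def pverts_hub_graph clique_size_def)
    \<comment> \<open>Twice the degree bound, rearranged to be free of truncated subtraction before
      passing to the reals.\<close>
    then have "n + d \<le> 2 * min_degree (hub_graph d) + 2"
      using min_degree_hub_graph[OF d] by linarith
    then have "real (n + d) \<le> real (2 * min_degree (hub_graph d) + 2)"
      by (rule of_nat_mono)
    then show ?thesis by (simp add: field_simps)
  qed
  ultimately show ?thesis
    unfolding n_def by linarith
qed

theorem theorem2:
  shows "\<exists>\<F> :: nat pair_pre_digraph set.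
    infinite \<F> \<and>
    pairwise (\<lambda>G H. \<not> digraph_iso (with_proj G) (with_proj H)) \<F> \<and>
    (\<forall>G \<in> \<F>.
       pair_graph G \<and> pverts G \<noteq> {} \<and>
       real (min_degree G) \<ge> real (graph_order G) / 2 + ln (real (graph_order G)) / (2 * ln (27 / 4)) \<and>
       \<not> (\<exists>D. orientation_of G D \<and> digraph_diameter D = 2))"
proof -
  \<comment> \<open>Since the order is an isomorphism invariant, its strict growth gives both the
    infinitude of the family and pairwise non-isomorphism.\<close>
  have order_less: "graph_order (hub_graph d) < graph_order (hub_graph e)" if "8 \<le> d" "d < e" for d e
    using that by (simp add: graph_order_hub_graph add_strict_mono)
  then have order_inj: "d = e"
    if "graph_order (hub_graph d) = graph_order (hub_graph e)" "8 \<le> d" "8 \<le> e" for d e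
    using that by (metis less_irrefl linorder_neqE_nat)
  have "inj_on hub_graph {8..}"
    by (rule inj_onI) (simp add: order_inj)
  then have "infinite (hub_graph ` {8..})"
    by (simp add: finite_image_iff infinite_Ici)
  moreover have "pairwise (\<lambda>G H. \<not> digraph_iso (with_proj G) (with_proj H)) (hub_graph ` {8..})"
    using order_inj by (fastforce simp: pairwise_def dest: digraph_iso_imp_graph_order_eq)
  moreover have "pverts (hub_graph d) \<noteq> {}" for d
    by (simp add: pverts_hub_graph lessThan_empty_iff)
  ultimately show ?thesis
    by (intro exI[of _ "hub_graph ` {8..}"])
      (auto simp: pair_graph_hub_graph min_degree_hub_graph_ge_log dest: hub_graph_not_orientable[rotated])
qed

end
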